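(* Let $G=(A\cup B,E)$ be a marriage instance with critical set $C\subseteq A$, and let $M$ be a popular feasible matching of $G$ that is neither a minimum size popular feasible matching nor a dominant feasible matching. Then $G$ contains a size reducing alternating path (SRAP) and a size increasing alternating path (SIAP) with respect to $M$, where levels are those assigned to $M$ by the leveling procedure described in the context.
   Context: A marriage instance is a bipartite graph $G=(A\cup B,E)$ ($A$ men, $B$ women) with strict preference lists; every vertex prefers being matched to any neighbour over being unmatched. For matchings $M,N$, $\phi(N,M)$ is the number of vertices preferring $N$ to $M$. A matching is feasible if it matches all of $C$; a popular feasible matching is a feasible $M$ with $\phi(N,M)\le\phi(M,N)$ for all feasible $N$; a minimum size popular feasible matching is one of minimum cardinality among popular feasible matchings; a dominant feasible matching is a popular feasible matching $M$ with $\phi(M,N)>\phi(N,M)$ for every feasible $N$ with $|N|>|M|$. Edge labels: for an edge $(u,v)\notin M$, $u$ gives label $+1$ if $u$ prefers $v$ to $M(u)$ (an unmatched vertex prefers any neighbour) and $-1$ otherwise; the label is written (man's label, woman's label). An alternating path with respect to $M$ is a path whose edges alternate between $M$ and $E\setminus M$. Leveling procedure applied to $M$: initially every vertex has level $0$. Repeat the following three phases until none changes any level: Phase 1: while some edge $(m,w)$ labelled $(+1,+1)$ has level$(w)\le$ level$(m)=i$, set level$(w)$=level$(M(w))=i+1$. Phase 2: while some edge $(m,w)$ labelled $(+1,-1)$ or $(-1,+1)$ has level$(w)<$ level$(m)=i$, set level$(w)$=level$(M(w))=i$. Phase 3: while some edge $(m,w)$ labelled $(-1,-1)$ has level$(w)\le$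 level$(m)-2$, level$(m)=i$, set level$(w)$=level$(M(w))=i-1$. An SRAP is an alternating path $\rho$ with respect to $M$ in which the number of $(+1,+1)$ edges is one more than the number of $(-1,-1)$ edges, which starts at a woman matched in $M$ at level $0$ and ends at a non-critical man (in $A\setminus C$) at level $1$. An SIAP is an alternating path with respect to $M$ with equally many $(+1,+1)$ and $(-1,-1)$ edges whose endpoints are a man and a woman both unmatched in $M$. *)

theory Defs
  imports Main
begin

(* An edge is a pair (m, w) of a man and a woman.  (x, y) \<in> pref G u means that
   u prefers the neighbour x to the neighbour y. *)
record 'v marriage =
  men :: "'v set"
  women :: "'v set"
  edges :: "('v \<times> 'v) set"
  pref :: "'v \<Rightarrow> ('v \<times> 'v) set"

definition joined :: "('v \<times> 'v) set \<Rightarrow> 'v \<Rightarrow> 'v \<Rightarrow> bool" where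
  "joined F u v \<longleftrightarrow> (u, v) \<in> F \<or> (v, u) \<in> F"

definition marriage_instance :: "'v marriage \<Rightarrow> bool" where
  "marriage_instance G \<longleftrightarrow>
     finite (men G) \<and> finite (women G) \<and> men G \<inter> women G = {} \<and>
     edges G \<subseteq> men G \<times> women G \<and>
     (\<forall>u \<in> men G \<union> women G. strict_linear_order_on {v. joined (edges G) u v} (pref G u))"

definition matched :: "('v \<times> 'v) set \<Rightarrow> 'v \<Rightarrow> bool" where
  "matched M u \<longleftrightarrow> (\<exists>v. joined M u v)"

definition matching :: "'v marriage \<Rightarrow> ('v \<times> 'v) set \<Rightarrow> bool" where
  "matching G M \<longleftrightarrow> M \<subseteq> edges G \<and> inj_on fst M \<and> inj_on snd M"

(* u prefers v to its partner M(u).  If u is unmatched in M this holds for every v. *)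
definition prefers_to_partner :: "'v marriage \<Rightarrow> ('v \<times> 'v) set \<Rightarrow> 'v \<Rightarrow> 'v \<Rightarrow> bool" where
  "prefers_to_partner G M u v \<longleftrightarrow> (\<forall>x. joined M u x \<longrightarrow> (v, x) \<in> pref G u)"

definition prefers_matching ::
  "'v marriage \<Rightarrow> 'v \<Rightarrow> ('v \<times> 'v) set \<Rightarrow> ('v \<times> 'v) set \<Rightarrow> bool" where
  "prefers_matching G u N M \<longleftrightarrow> (\<exists>v. joined N u v \<and> prefers_to_partner G M u v)"

definition phi :: "'v marriage \<Rightarrow> ('v \<times> 'v) set \<Rightarrow> ('v \<times> 'v) set \<Rightarrow> nat" where
  "phi G N M = card {u \<in> men G \<union> women G. prefers_matching G u N M}"

definition feasible :: "'v marriage \<Rightarrow> 'v set \<Rightarrow> ('v \<times> 'v) set \<Rightarrow> bool" where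
  "feasible G C M \<longleftrightarrow> matching G M \<and> (\<forall>c \<in> C. matched M c)"

definition popular_feasible :: "'v marriage \<Rightarrow> 'v set \<Rightarrow> ('v \<times> 'v) set \<Rightarrow> bool" where
  "popular_feasible G C M \<longleftrightarrow>
     feasible G C M \<and> (\<forall>N. feasible G C N \<longrightarrow> phi G N M \<le> phi G M N)"

definition min_size_popular_feasible :: "'v marriage \<Rightarrow> 'v set \<Rightarrow> ('v \<times> 'v) set \<Rightarrow> bool" where
  "min_size_popular_feasible G C M \<longleftrightarrow>
     popular_feasible G C M \<and> (\<forall>N. popular_feasible G C N \<longrightarrow> card M \<le> card N)"

definition dominant_feasible :: "'v marriage \<Rightarrow> 'v set \<Rightarrow> ('v \<times> 'v) set \<Rightarrow> bool" where
  "dominant_feasible G C M \<longleftrightarrow>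
     popular_feasible G C M \<and>
     (\<forall>N. feasible G C N \<and> card N > card M \<longrightarrow> phi G M N > phi G N M)"

definition vote :: "'v marriage \<Rightarrow> ('v \<times> 'v) set \<Rightarrow> 'v \<Rightarrow> 'v \<Rightarrow> int" where
  "vote G M u v = (if prefers_to_partner G M u v then 1 else -1)"

(* Only meaningful for edges outside M; every use below restricts to such edges. *)
definition edge_label :: "'v marriage \<Rightarrow> ('v \<times> 'v) set \<Rightarrow> 'v \<times> 'v \<Rightarrow> int \<times> int" where
  "edge_label G M e = (vote G M (fst e) (snd e), vote G M (snd e) (fst e))"

(* level(w) = level(M(w)) = k; if w is unmatched in M, only the level of w is set. *)
definition set_level :: "('v \<times> 'v) set \<Rightarrow> 'v \<Rightarrow> int \<Rightarrow> ('v \<Rightarrow> int) \<Rightarrow> ('v \<Rightarrow> int)" where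
  "set_level M w k lev = (\<lambda>v. if v = w \<or> joined M w v then k else lev v)"

definition step1 :: "'v marriage \<Rightarrow> ('v \<times> 'v) set \<Rightarrow> ('v \<Rightarrow> int) \<Rightarrow> ('v \<Rightarrow> int) \<Rightarrow> bool" where
  "step1 G M lev lev' \<longleftrightarrow>
     (\<exists>m w. (m, w) \<in> edges G - M \<and> edge_label G M (m, w) = (1, 1) \<and>
            lev w \<le> lev m \<and> lev' = set_level M w (lev m + 1) lev)"

definition step2 :: "'v marriage \<Rightarrow> ('v \<times> 'v) set \<Rightarrow> ('v \<Rightarrow> int) \<Rightarrow> ('v \<Rightarrow> int) \<Rightarrow> bool" where
  "step2 G M lev lev' \<longleftrightarrow>
     (\<exists>m w. (m, w) \<in> edges G - M \<and> edge_label G M (m, w) \<in> {(1, -1), (-1, 1)} \<and>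
            lev w < lev m \<and> lev' = set_level M w (lev m) lev)"

definition step3 :: "'v marriage \<Rightarrow> ('v \<times> 'v) set \<Rightarrow> ('v \<Rightarrow> int) \<Rightarrow> ('v \<Rightarrow> int) \<Rightarrow> bool" where
  "step3 G M lev lev' \<longleftrightarrow>
     (\<exists>m w. (m, w) \<in> edges G - M \<and> edge_label G M (m, w) = (-1, -1) \<and>
            lev w \<le> lev m - 2 \<and> lev' = set_level M w (lev m - 1) lev)"

(* A complete execution of a nondeterministic while loop with body step. *)
definition while_run :: "('s \<Rightarrow> 's \<Rightarrow> bool) \<Rightarrow> 's \<Rightarrow> 's \<Rightarrow> bool" where
  "while_run step s t \<longleftrightarrow> step\<^sup>*\<^sup>* s t \<and> (\<nexists>u. step t u)"

definition leveling_round ::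
  "'v marriage \<Rightarrow> ('v \<times> 'v) set \<Rightarrow> ('v \<Rightarrow> int) \<Rightarrow> ('v \<Rightarrow> int) \<Rightarrow> bool" where
  "leveling_round G M =
     while_run (step1 G M) OO while_run (step2 G M) OO while_run (step3 G M)"

(* lev is the outcome of some terminating execution of the leveling procedure on M:
   it is reached by finitely many rounds, and from lev no phase changes any level. *)
definition leveling :: "'v marriage \<Rightarrow> ('v \<times> 'v) set \<Rightarrow> ('v \<Rightarrow> int) \<Rightarrow> bool" where
  "leveling G M lev \<longleftrightarrow>
     (leveling_round G M)\<^sup>*\<^sup>* (\<lambda>_. 0) lev \<and>
     while_run (step1 G M) lev lev \<and>
     while_run (step2 G M) lev lev \<and>
     while_run (step3 G M) lev lev"

definition alternating_path :: "'v marriage \<Rightarrow> ('v \<times> 'v) set \<Rightarrow> 'v list \<Rightarrow> bool" where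
  "alternating_path G M p \<longleftrightarrow>
     p \<noteq> [] \<and> set p \<subseteq> men G \<union> women G \<and> distinct p \<and>
     (\<forall>i. Suc i < length p \<longrightarrow> joined (edges G) (p ! i) (p ! Suc i)) \<and>
     (\<forall>i. Suc (Suc i) < length p \<longrightarrow>
        (joined M (p ! i) (p ! Suc i) \<longleftrightarrow> \<not> joined M (p ! Suc i) (p ! Suc (Suc i))))"

definition path_edges :: "'v marriage \<Rightarrow> 'v list \<Rightarrow> ('v \<times> 'v) set" where
  "path_edges G p =
     {e \<in> edges G. \<exists>i. Suc i < length p \<and> (e = (p ! i, p ! Suc i) \<or> e = (p ! Suc i, p ! i))}"

definition num_label ::
  "'v marriage \<Rightarrow> ('v \<times> 'v) set \<Rightarrow> 'v list \<Rightarrow> int \<times> int \<Rightarrow> nat" where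
  "num_label G M p l = card {e \<in> path_edges G p - M. edge_label G M e = l}"

definition SRAP ::
  "'v marriage \<Rightarrow> 'v set \<Rightarrow> ('v \<times> 'v) set \<Rightarrow> ('v \<Rightarrow> int) \<Rightarrow> 'v list \<Rightarrow> bool" where
  "SRAP G C M lev p \<longleftrightarrow>
     alternating_path G M p \<and>
     num_label G M p (1, 1) = num_label G M p (-1, -1) + 1 \<and>
     hd p \<in> women G \<and> matched M (hd p) \<and> lev (hd p) = 0 \<and>
     last p \<in> men G - C \<and> lev (last p) = 1"

definition SIAP :: "'v marriage \<Rightarrow> ('v \<times> 'v) set \<Rightarrow> 'v list \<Rightarrow> bool" where
  "SIAP G M p \<longleftrightarrow>
     alternating_path G M p \<and>
     num_label G M p (1, 1) = num_label G M p (-1, -1) \<and>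
     (hd p \<in> men G \<and> last p \<in> women G \<or> hd p \<in> women G \<and> last p \<in> men G) \<and>
     \<not> matched M (hd p) \<and> \<not> matched M (last p)"

end

(* The symmetric difference of two popular matchings splits into alternating paths and cycles.
   Exchanging along a single component keeps feasibility, so by popularity no component votes
   against M; if M and N tie, every component ties. A feasible N that ties with M and is larger
   than M has a component ending at two vertices unmatched in M, and a tie means that it is an
   SIAP; a smaller N gives a component on which the +1 votes exceed the -1 votes by the two lost
   end vertices, i.e. a path with one more (+1,+1) than (-1,-1) edges.

   All three phases relax one inequality level(w) >= level(m) + gain(m,w), where the gain is half
   the sum of the two labels. Hence a level is bounded by the gain of an alternating path from
   level 0 (cycles have no positive gain by popularity), so the procedure terminates, and no
   non-critical man exceeds level 1, as exchanging along that path would beat M. The path above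
   climbs by at least 1 from a level >= 0 to a non-critical man, hence exactly from 0 to 1. *)
theory Submission imports Defs begin

section \<open>Gains of edges and label counts\<close>

text \<open>Both votes are 1 or -1, so the halving is exact: the labels (+1,+1), mixed and (-1,-1)
  have gain 1, 0 and -1.\<close>

definition gain :: "'v marriage \<Rightarrow> ('v \<times> 'v) set \<Rightarrow> 'v \<times> 'v \<Rightarrow> int" where
  "gain G M e = (vote G M (fst e) (snd e) + vote G M (snd e) (fst e)) div 2"

lemma two_gain: "2 * gain G M e = vote G M (fst e) (snd e) + vote G M (snd e) (fst e)"
  by (auto simp: gain_def vote_def)

lemma gain_le_1: "gain G M e \<le> 1"
  by (auto simp: gain_def vote_def)

lemma edge_label_cases:
  obtains "edge_label G M e = (1, 1)" "gain G M e = 1"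
  | "edge_label G M e = (1, -1)" "gain G M e = 0"
  | "edge_label G M e = (-1, 1)" "gain G M e = 0"
  | "edge_label G M e = (-1, -1)" "gain G M e = -1"
  by (cases "prefers_to_partner G M (fst e) (snd e)"; cases "prefers_to_partner G M (snd e) (fst e)")
    (simp_all add: edge_label_def gain_def vote_def)

text \<open>Mixed labels have gain 0, so only the two pure labels survive in the sum, with opposite
  signs. All later label counts go through this identity.\<close>

lemma num_label_diff:
  assumes "finite (path_edges G p - M)"
  shows "int (num_label G M p (1, 1)) - int (num_label G M p (-1, -1)) =
    sum (gain G M) (path_edges G p - M)"
proof -
  let ?E = "path_edges G p - M"
  have "gain G M e = of_bool (edge_label G M e = (1, 1)) - of_bool (edge_label G M e = (-1, -1))" for e
    by (rule edge_label_cases[of G M e]) auto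
  then have "sum (gain G M) ?E =
      (\<Sum>e\<in>?E. of_bool (edge_label G M e = (1, 1))) - (\<Sum>e\<in>?E. of_bool (edge_label G M e = (-1, -1)))"
    by (simp add: sum_subtractf)
  also have "\<dots> = int (num_label G M p (1, 1)) - int (num_label G M p (-1, -1))"
    using assms by (simp add: num_label_def sum_of_bool_eq Int_def)
  finally show ?thesis by simp
qed

section \<open>Ballots of vertices and exchange on a union of components\<close>

text \<open>In contrast to \<open>vote\<close>, a vertex with the same situation in both matchings
  counts 0. Summed over all vertices this is the popularity margin of \<open>N\<close> over
  \<open>M\<close>.\<close>

definition ballot :: "'v marriage \<Rightarrow> ('v \<times> 'v) set \<Rightarrow> ('v \<times> 'v) set \<Rightarrow> 'v \<Rightarrow> int" where
  "ballot G N M u = of_bool (prefers_matching G u N M) - of_bool (prefers_matching G u M N)"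

text \<open>For \<open>F = M \<union> N\<close> such a set is a union of connected components of the
  graph with edge set \<open>M \<union> N\<close>.\<close>

definition closed_under :: "('v \<times> 'v) set \<Rightarrow> 'v set \<Rightarrow> bool" where
  "closed_under F D \<longleftrightarrow> (\<forall>(m, w) \<in> F. m \<in> D \<longleftrightarrow> w \<in> D)"

text \<open>Testing the man alone is enough, since the sets \<open>D\<close> of interest are closed
  under \<open>M \<union> N\<close> and the woman then lies on the same side.\<close>

definition swap_on :: "('v \<times> 'v) set \<Rightarrow> ('v \<times> 'v) set \<Rightarrow> 'v set \<Rightarrow> ('v \<times> 'v) set" where
  "swap_on M N D = {e \<in> M. fst e \<notin> D} \<union> {e \<in> N. fst e \<in> D}"

lemma joined_swap_on:
  assumes "closed_under (M \<union> N) D"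
  shows "joined (swap_on M N D) u v \<longleftrightarrow> (if u \<in> D then joined N u v else joined M u v)"
  using assms by (auto simp: closed_under_def joined_def swap_on_def)

lemma matchingI:
  assumes "M \<subseteq> edges G"
    and "\<And>m w w'. (m, w) \<in> M \<Longrightarrow> (m, w') \<in> M \<Longrightarrow> w = w'"
    and "\<And>m m' w. (m, w) \<in> M \<Longrightarrow> (m', w) \<in> M \<Longrightarrow> m = m'"
  shows "matching G M"
  unfolding matching_def
proof (intro conjI inj_onI)
  show "M \<subseteq> edges G" by fact
  fix e f assume "e \<in> M" "f \<in> M"
  then show "fst e = fst f \<Longrightarrow> e = f" "snd e = snd f \<Longrightarrow> e = f"
    using assms(2,3) by (cases e; cases f; fastforce)+
qed

lemma matching_unique_woman: "matching G M \<Longrightarrow> (m, w) \<in> M \<Longrightarrow> (m, w') \<in> M \<Longrightarrow> w = w'"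
  unfolding matching_def inj_on_def by fastforce

lemma matching_unique_man: "matching G M \<Longrightarrow> (m, w) \<in> M \<Longrightarrow> (m', w) \<in> M \<Longrightarrow> m = m'"
  unfolding matching_def inj_on_def by fastforce

text \<open>By closedness all edges at a vertex come from one and the same of the two matchings, so
  uniqueness of partners and the coverage of \<open>C\<close> are inherited vertex by
  vertex.\<close>

lemma feasible_swap_on:
  assumes M: "feasible G C M" and N: "feasible G C N" and D: "closed_under (M \<union> N) D"
  shows "feasible G C (swap_on M N D)"
proof -
  have m: "matching G M" "matching G N" using M N by (auto simp: feasible_def)
  have "matching G (swap_on M N D)"
  proof (rule matchingI)
    show "swap_on M N D \<subseteq> edges G"
      using m by (auto simp: swap_on_def matching_def)
  next
    fix x y z assume "(x, y) \<in> swap_on M N D" "(x, z) \<in> swap_on M N D"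
    then show "y = z"
      using m by (auto simp: swap_on_def dest: matching_unique_woman)
  next
    fix x y z assume "(x, z) \<in> swap_on M N D" "(y, z) \<in> swap_on M N D"
    moreover have "x \<in> D \<longleftrightarrow> z \<in> D" "y \<in> D \<longleftrightarrow> z \<in> D"
      using calculation D by (auto simp: swap_on_def closed_under_def)
    ultimately show "x = y"
      using m by (auto simp: swap_on_def dest: matching_unique_man)
  qed
  then show ?thesis
    using M N by (auto simp: feasible_def matched_def joined_swap_on[OF D])
qed

section \<open>Alternating chains between two matchings of different size\<close>

text \<open>The women of \<open>M\<close> outnumber those of \<open>N\<close>, so some \<open>M\<close>-edge has a woman not covered by \<open>N\<close>.
  Deleting its man from both matchings keeps the inequality, and a chain of the remaining
  matchings either is already a chain or can be prolonged by the deleted man.\<close>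
lemma exists_chain:
  fixes M N :: "('a \<times> 'a) set"
  assumes "finite M" "finite N" "inj_on fst M" "inj_on snd M" "inj_on fst N" "inj_on snd N"
    and "card N < card M"
  shows "\<exists>(k::nat) m w. (\<forall>i\<le>k. (m i, w i) \<in> M) \<and> (\<forall>i<k. (m i, w (Suc i)) \<in> N) \<and>
    inj_on m {..k} \<and> inj_on w {..k} \<and> w 0 \<notin> snd ` N \<and> m k \<notin> fst ` N"
  using assms
proof (induction "card M" arbitrary: M N rule: less_induct)
  case (less M N)
  have "card (snd ` N) < card (snd ` M)"
    using less.prems by (simp add: card_image)
  then have "\<not> snd ` M \<subseteq> snd ` N"
    using less.prems by (meson card_mono finite_imageI not_less)
  then obtain m0 w0 where e: "(m0, w0) \<in> M" "w0 \<notin> snd ` N" by force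
  show ?case
  proof (cases "m0 \<in> fst ` N")
    case False
    then show ?thesis
      using e by (intro exI[of _ 0] exI[of _ "\<lambda>_. m0"] exI[of _ "\<lambda>_. w0"]) auto
  next
    case True
    then obtain w1 where w1: "(m0, w1) \<in> N" by auto
    let ?M = "M - {(m0, w0)}" and ?N = "N - {(m0, w1)}"
    have only: "x = m0 \<and> y = w0" if "(x, y) \<in> M" "x = m0 \<or> y = w0" for x y
      using inj_onD[OF less.prems(3) _ that(1) e(1)] inj_onD[OF less.prems(4) _ that(1) e(1)] that(2)
      by auto
    have notM: "m0 \<notin> fst ` ?M" "w0 \<notin> snd ` ?M" by (auto dest: only)
    have card: "card ?M < card M" "card ?N < card ?M"
      using less.prems e(1) w1
      by (simp_all add: card_Diff1_less)
        (metis card_0_eq card_gt_0_iff diff_less_mono empty_iff Suc_leI less_one not_less)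
    have fin: "finite ?M" "finite ?N" using less.prems(1,2) by auto
    have inj: "inj_on fst ?M" "inj_on snd ?M" "inj_on fst ?N" "inj_on snd ?N"
      using less.prems(3-6) by (auto intro: inj_on_diff)
    obtain k m w where
      c: "\<forall>i\<le>k. (m i, w i) \<in> ?M" "\<forall>i<k. (m i, w (Suc i)) \<in> ?N"
        "inj_on m {..k}" "inj_on w {..k}" "w 0 \<notin> snd ` ?N" "m k \<notin> fst ` ?N"
      using less.hyps[OF card(1) fin inj card(2)] by (elim exE conjE) (rule that)
    have mne: "m i \<noteq> m0" "w i \<noteq> w0" if "i \<le> k" for i
      using c(1) notM that by (metis fst_conv snd_conv image_eqI)+
    have mk: "m k \<notin> fst ` N" using c(6) mne(1)[of k] by (auto simp: image_iff)
    show ?thesis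
    \<comment> \<open>The deletion of \<open>(m0, w1)\<close> uncovers at most the woman
      \<open>w1\<close>, so only a chain starting at \<open>w1\<close> fails to be a chain for
      \<open>N\<close> itself.\<close>
    proof (cases "w 0 = w1")
      case False
      then have w0: "w 0 \<notin> snd ` N" using c(5) by (auto simp: image_iff)
      have "\<forall>i\<le>k. (m i, w i) \<in> M" "\<forall>i<k. (m i, w (Suc i)) \<in> N" using c(1,2) by simp_all
      then show ?thesis using c(3,4) w0 mk by (intro exI[of _ k] exI[of _ m] exI[of _ w] conjI)
    next
      case True
      \<comment> \<open>The indices shift by one and the edge \<open>(m0, w0)\<close> becomes the
        new first edge, linked to the old chain by \<open>(m0, w1)\<close>.\<close>
      let ?m = "case_nat m0 m" and ?w = "case_nat w0 w"
      have "\<forall>i\<le>Suc k. (?m i, ?w i) \<in> M" using e c(1) by (auto split: nat.splits)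
      moreover have "\<forall>i<Suc k. (?m i, ?w (Suc i)) \<in> N"
        using True w1 c(2) by (auto split: nat.splits)
      moreover have "inj_on ?m {..Suc k}" "inj_on ?w {..Suc k}"
        using c(3,4) mne mne[THEN not_sym] by (auto simp: inj_on_def split: nat.splits)
      ultimately show ?thesis
        using mk e(2) by (intro exI[of _ "Suc k"] exI[of _ ?m] exI[of _ ?w]) auto
    qed
  qed
qed

section \<open>The three phases as one relaxation step, and complete runs of loops\<close>

text \<open>One edge relaxation, as in a longest path computation in which edges outside
  \<open>M\<close> have their gain as length and edges of \<open>M\<close> have length 0.\<close>

definition raise :: "'v marriage \<Rightarrow> ('v \<times> 'v) set \<Rightarrow> ('v \<Rightarrow> int) \<Rightarrow> ('v \<Rightarrow> int) \<Rightarrow> bool" where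
  "raise G M lev lev' \<longleftrightarrow> (\<exists>m w. (m, w) \<in> edges G - M \<and> lev w < lev m + gain G M (m, w) \<and>
     lev' = set_level M w (lev m + gain G M (m, w)) lev)"

text \<open>For gains 1, 0 and -1 the integer condition \<open>lev w < lev m + gain\<close> reads
  \<open>lev w \<le> lev m\<close>, \<open>lev w < lev m\<close> and
  \<open>lev w \<le> lev m - 2\<close>: the guards of the three phases.\<close>

lemma raise_iff_step: "raise G M = sup (step1 G M) (sup (step2 G M) (step3 G M))"
proof (intro ext iffI)
  fix lev lev' assume "raise G M lev lev'"
  then obtain m w where *: "(m, w) \<in> edges G - M" "lev w < lev m + gain G M (m, w)"
     "lev' = set_level M w (lev m + gain G M (m, w)) lev"
    unfolding raise_def by blast
  show "sup (step1 G M) (sup (step2 G M) (step3 G M)) lev lev'"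
  proof (rule edge_label_cases[of G M "(m, w)"])
    assume "edge_label G M (m, w) = (1, 1)" "gain G M (m, w) = 1"
    then have "step1 G M lev lev'" using * unfolding step1_def by force
    then show ?thesis by simp
  next
    assume "edge_label G M (m, w) = (1, -1)" "gain G M (m, w) = 0"
    then have "step2 G M lev lev'" using * unfolding step2_def by force
    then show ?thesis by simp
  next
    assume "edge_label G M (m, w) = (-1, 1)" "gain G M (m, w) = 0"
    then have "step2 G M lev lev'" using * unfolding step2_def by force
    then show ?thesis by simp
  next
    assume "edge_label G M (m, w) = (-1, -1)" "gain G M (m, w) = -1"
    then have "step3 G M lev lev'" using * unfolding step3_def by force
    then show ?thesis by simp
  qed
next
  fix lev lev' assume "sup (step1 G M) (sup (step2 G M) (step3 G M)) lev lev'"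
  then consider "step1 G M lev lev'" | "step2 G M lev lev'" | "step3 G M lev lev'" by auto
  then show "raise G M lev lev'"
  proof cases
    case 1
    then obtain m w where "(m, w) \<in> edges G - M" "edge_label G M (m, w) = (1, 1)"
      "lev w \<le> lev m" "lev' = set_level M w (lev m + 1) lev" by (auto simp: step1_def)
    then show ?thesis
      unfolding raise_def
      by (intro exI[of _ m] exI[of _ w]) (rule edge_label_cases[of G M "(m, w)"]; simp)
  next
    case 2
    then obtain m w where "(m, w) \<in> edges G - M" "edge_label G M (m, w) \<in> {(1, -1), (-1, 1)}"
      "lev w < lev m" "lev' = set_level M w (lev m) lev" by (auto simp: step2_def)
    then show ?thesis
      unfolding raise_def
      by (intro exI[of _ m] exI[of _ w]) (rule edge_label_cases[of G M "(m, w)"]; simp)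
  next
    case 3
    then obtain m w where "(m, w) \<in> edges G - M" "edge_label G M (m, w) = (-1, -1)"
      "lev w \<le> lev m - 2" "lev' = set_level M w (lev m - 1) lev" by (auto simp: step3_def)
    then show ?thesis
      unfolding raise_def
      by (intro exI[of _ m] exI[of _ w]) (rule edge_label_cases[of G M "(m, w)"]; simp)
  qed
qed

text \<open>The last conjunct records that a run that does anything at all decreases the measure
  strictly; this lets the measure be compared across a whole round of phases.\<close>

lemma while_run_exists:
  fixes \<mu> :: "'s \<Rightarrow> nat"
  assumes step: "\<And>s t. P s \<Longrightarrow> step s t \<Longrightarrow> P t \<and> \<mu> t < \<mu> s" and "P s"
  shows "\<exists>t. while_run step s t \<and> P t \<and> \<mu> t \<le> \<mu> s \<and> ((\<exists>u. step s u) \<longrightarrow> \<mu> t < \<mu> s)"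
  using \<open>P s\<close>
proof (induction "\<mu> s" arbitrary: s rule: less_induct)
  case less
  show ?case
  proof (cases "\<exists>u. step s u")
    case False
    then show ?thesis using less.prems by (auto simp: while_run_def)
  next
    case True
    then obtain u where u: "step s u" by blast
    then have "P u" "\<mu> u < \<mu> s" using step less.prems by blast+
    with less.hyps obtain t where "while_run step u t" "P t" "\<mu> t \<le> \<mu> u" by blast
    then show ?thesis
      using u \<open>\<mu> u < \<mu> s\<close> by (auto simp: while_run_def intro!: exI[of _ t])
  qed
qed

section \<open>Vote counts in a marriage instance and local consequences of popularity\<close>

locale marriage =
  fixes G :: "'v marriage"
  assumes is_instance: "marriage_instance G"
begin

abbreviation vertices :: "'v set" where "vertices \<equiv> men G \<union> women G"

lemma finite_vertices: "finite vertices"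
  and not_man_and_woman: "v \<in> men G \<Longrightarrow> v \<notin> women G"
  and edges_subset: "edges G \<subseteq> men G \<times> women G"
  using is_instance by (auto simp: marriage_instance_def)

lemma finite_edges: "finite (edges G)"
  using finite_subset[OF edges_subset] finite_vertices by simp

lemma edge_man: "(m, w) \<in> edges G \<Longrightarrow> m \<in> men G"
  and edge_woman: "(m, w) \<in> edges G \<Longrightarrow> w \<in> women G"
  using edges_subset by auto

lemma finite_matching: "matching G M \<Longrightarrow> finite M"
  using finite_edges finite_subset by (auto simp: matching_def)

lemma joined_unique:
  assumes "matching G M" "joined M u v" "joined M u v'"
  shows "v = v'"
proof -
  have "(x, y) \<in> M \<Longrightarrow> x \<in> men G - women G \<and> y \<in> women G - men G" for x y
    using assms(1) edges_subset not_man_and_woman unfolding matching_def by blast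
  then show ?thesis
    using assms matching_unique_woman[OF assms(1)] matching_unique_man[OF assms(1)]
    unfolding joined_def by (metis DiffD1 DiffD2)
qed

lemma pref_irrefl: "u \<in> vertices \<Longrightarrow> (x, x) \<notin> pref G u"
  using is_instance by (auto simp: marriage_instance_def strict_linear_order_on_def irrefl_def)

lemma pref_asym: "u \<in> vertices \<Longrightarrow> (x, y) \<in> pref G u \<Longrightarrow> (y, x) \<notin> pref G u"
  using is_instance pref_irrefl[of u x] transD[of "pref G u" x y x]
  unfolding marriage_instance_def strict_linear_order_on_def by blast

lemma pref_total:
  "u \<in> vertices \<Longrightarrow> joined (edges G) u x \<Longrightarrow> joined (edges G) u y \<Longrightarrow> x \<noteq> y \<Longrightarrow>
    (x, y) \<in> pref G u \<or> (y, x) \<in> pref G u"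
  using is_instance by (auto simp: marriage_instance_def strict_linear_order_on_def total_on_def)

lemma phi_diff: "int (phi G N M) - int (phi G M N) = sum (ballot G N M) vertices"
  using finite_vertices
  by (simp add: phi_def ballot_def sum_subtractf sum_of_bool_eq Int_def)

lemma ballot_same:
  assumes "u \<in> vertices" "\<And>v. joined N u v \<longleftrightarrow> joined M u v"
  shows "ballot G N M u = 0"
  using assms(2) pref_irrefl[OF assms(1)]
  by (auto simp: ballot_def prefers_matching_def prefers_to_partner_def)

lemma ballot_lost:
  assumes "matched M u" "\<not> matched N u"
  shows "ballot G N M u = -1"
  using assms by (auto simp: ballot_def prefers_matching_def prefers_to_partner_def matched_def)

text \<open>A vertex with a new partner is never indifferent: its preferences are total and
  asymmetric, so if it does not prefer \<open>v\<close> to its old partner, it prefers the old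
  partner to \<open>v\<close>.\<close>

lemma ballot_vote:
  assumes M: "matching G M" and N: "matching G N" and "u \<in> vertices" "joined N u v" "\<not> joined M u v"
  shows "ballot G N M u = vote G M u v"
proof -
  have 1: "prefers_matching G u N M \<longleftrightarrow> prefers_to_partner G M u v"
    unfolding prefers_matching_def using joined_unique[OF N] assms(4) by blast
  have 2: "prefers_matching G u M N \<longleftrightarrow> (\<exists>x. joined M u x \<and> (x, v) \<in> pref G u)"
    unfolding prefers_matching_def prefers_to_partner_def using joined_unique[OF N] assms(4) by blast
  have sub: "joined M u x \<Longrightarrow> joined (edges G) u x" "joined N u x \<Longrightarrow> joined (edges G) u x" for x
    using M N by (auto simp: matching_def joined_def)
  show ?thesis
  proof (cases "matched M u")
    case False
    then show ?thesis using 1 2 by (auto simp: ballot_def vote_def matched_def prefers_to_partner_def)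
  next
    case True
    then obtain x where x: "joined M u x" by (auto simp: matched_def)
    have "(x, v) \<in> pref G u \<longleftrightarrow> (v, x) \<notin> pref G u"
      using pref_total[OF assms(3) sub(1)[OF x] sub(2)[OF assms(4)]] pref_asym[OF assms(3)] x assms(5)
      by blast
    moreover have "joined M u y \<longleftrightarrow> y = x" for y using joined_unique[OF M] x by blast
    ultimately show ?thesis
      using 1 2 by (auto simp: ballot_def vote_def prefers_to_partner_def)
  qed
qed

text \<open>The vertices of \<open>D\<close> fall into four classes: men of new edges, women of new
  edges, vertices that lose their partner, and vertices where nothing changes. The first two classes
  cast the two votes of each new edge, hence twice its gain; a lost partner costs one vote; the rest
  abstains.\<close>

lemma sum_ballot_closed:
  assumes M: "matching G M" and N: "matching G N" and D: "D \<subseteq> vertices" "closed_under (M \<union> N) D"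
  shows "sum (ballot G N M) D =
    2 * sum (gain G M) {e \<in> N - M. fst e \<in> D} - int (card {u \<in> D. matched M u \<and> \<not> matched N u})"
proof -
  let ?F = "{e \<in> N - M. fst e \<in> D}" and ?L = "{u \<in> D. matched M u \<and> \<not> matched N u}"
  let ?R = "D - (fst ` ?F \<union> snd ` ?F \<union> ?L)"
  have fin: "finite D" using D(1) finite_vertices finite_subset by blast
  have NE: "N \<subseteq> men G \<times> women G" "M \<subseteq> men G \<times> women G"
    using M N edges_subset by (auto simp: matching_def)
  have FD: "fst ` ?F \<subseteq> D" "snd ` ?F \<subseteq> D"
    using D(2) by (auto simp: closed_under_def)
  have FN: "joined N u v" "joined N v u" "\<not> joined M u v" "\<not> joined M v u" if "(u, v) \<in> ?F" for u v
    using that NE not_man_and_woman by (auto simp: joined_def)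
  have sides: "fst ` ?F \<subseteq> men G" "snd ` ?F \<subseteq> women G" using NE(1) by auto
  have "u \<notin> fst ` ?F" "u \<notin> snd ` ?F" if "u \<in> ?L" for u
    using that by (auto simp: matched_def joined_def)
  then have disj_L: "fst ` ?F \<inter> ?L = {}" "snd ` ?F \<inter> ?L = {}" by blast+
  have split: "D = fst ` ?F \<union> (snd ` ?F \<union> (?L \<union> ?R))" using FD by auto
  have "fst ` ?F \<inter> snd ` ?F = {}"
    using sides not_man_and_woman by (meson disjoint_iff subsetD)
  then have disj: "fst ` ?F \<inter> (snd ` ?F \<union> (?L \<union> ?R)) = {}" "snd ` ?F \<inter> (?L \<union> ?R) = {}" "?L \<inter> ?R = {}"
    using disj_L by blast+
  have finF: "finite (fst ` ?F)" "finite (snd ` ?F)" using FD fin finite_subset by blast+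
  have rest: "ballot G N M u = 0" if "u \<in> ?R" for u
  proof (rule ballot_same)
    show "u \<in> vertices" using that D by blast
    fix v
    have nF: "(u, x) \<notin> ?F \<and> (x, u) \<notin> ?F" for x using that by force
    have *: "joined N u x \<Longrightarrow> joined M u x" for x
      using nF[of x] that D(2) by (auto simp: joined_def closed_under_def)
    show "joined N u v \<longleftrightarrow> joined M u v"
    proof
      assume v: "joined M u v"
      then have "matched N u" using that by (auto simp: matched_def)
      then obtain x where x: "joined N u x" by (auto simp: matched_def)
      with * have "joined M u x" by blast
      then have "x = v" using joined_unique[OF M] v by blast
      then show "joined N u v" using x by simp
    qed (rule *)
  qed
  have "sum (ballot G N M) D = sum (ballot G N M) (fst ` ?F) + (sum (ballot G N M) (snd ` ?F)
      + (sum (ballot G N M) ?L + sum (ballot G N M) ?R))"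
    using fin finF disj by (subst split) (simp add: sum.union_disjoint)
  also have "sum (ballot G N M) ?R = 0" using rest by (rule sum.neutral[OF ballI])
  also have "sum (ballot G N M) ?L = (\<Sum>u\<in>?L. -1)"
    by (rule sum.cong) (auto simp: ballot_lost)
  also have "sum (ballot G N M) (fst ` ?F) = (\<Sum>e\<in>?F. vote G M (fst e) (snd e))"
  proof (subst sum.reindex)
    show "inj_on fst ?F" using N by (auto simp: matching_def inj_on_def)
    show "sum (ballot G N M \<circ> fst) ?F = (\<Sum>e\<in>?F. vote G M (fst e) (snd e))"
      using FN FD(1) D(1) by (intro sum.cong) (auto intro!: ballot_vote[OF M N])
  qed
  also have "sum (ballot G N M) (snd ` ?F) = (\<Sum>e\<in>?F. vote G M (snd e) (fst e))"
  proof (subst sum.reindex)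
    show "inj_on snd ?F" using N by (auto simp: matching_def inj_on_def)
    show "sum (ballot G N M \<circ> snd) ?F = (\<Sum>e\<in>?F. vote G M (snd e) (fst e))"
      using FN NE by (intro sum.cong) (auto intro!: ballot_vote[OF M N])
  qed
  finally show ?thesis
    by (simp add: sum_distrib_left two_gain sum.distrib)
qed

text \<open>Replacing \<open>M\<close> by \<open>N\<close> inside \<open>D\<close> only gives a
  feasible matching, and outside \<open>D\<close> nobody notices, so its whole margin over
  \<open>M\<close> is the sum over \<open>D\<close>.\<close>

lemma popular_closed_sum_le:
  assumes M: "popular_feasible G C M" and N: "feasible G C N"
    and D: "D \<subseteq> vertices" "closed_under (M \<union> N) D"
  shows "sum (ballot G N M) D \<le> 0"
proof -
  let ?S = "swap_on M N D"
  have fM: "feasible G C M" using M by (simp add: popular_feasible_def)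
  have S: "feasible G C ?S" by (rule feasible_swap_on[OF fM N D(2)])
  have mM: "matching G M" and mS: "matching G ?S" using fM S by (auto simp: feasible_def)
  have in_D: "ballot G ?S M u = ballot G N M u" if "u \<in> D" for u
    using that by (simp add: ballot_def prefers_matching_def prefers_to_partner_def joined_swap_on[OF D(2)])
  have out_D: "ballot G ?S M u = 0" if "u \<in> vertices - D" for u
    using that by (intro ballot_same) (auto simp: joined_swap_on[OF D(2)])
  have "sum (ballot G N M) D = sum (ballot G ?S M) D"
    using in_D by simp
  also have "\<dots> = sum (ballot G ?S M) vertices"
    using out_D D(1) finite_vertices by (intro sum.mono_neutral_left) auto
  also have "\<dots> = int (phi G ?S M) - int (phi G M ?S)" by (simp add: phi_diff)
  also have "\<dots> \<le> 0" using M S by (simp add: popular_feasible_def)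
  finally show ?thesis .
qed

text \<open>The complement of \<open>D\<close> is closed too. Both sums are therefore nonpositive,
  and in a tie they add up to 0.\<close>

lemma popular_closed_sum_eq_0:
  assumes M: "popular_feasible G C M" and N: "feasible G C N" and eq: "phi G N M = phi G M N"
    and D: "D \<subseteq> vertices" "closed_under (M \<union> N) D"
  shows "sum (ballot G N M) D = 0"
proof -
  have ME: "M \<union> N \<subseteq> men G \<times> women G"
    using M N edges_subset by (auto simp: popular_feasible_def feasible_def matching_def)
  have "closed_under (M \<union> N) (vertices - D)"
    using D(2) ME by (auto simp: closed_under_def)
  then have "sum (ballot G N M) (vertices - D) \<le> 0" "sum (ballot G N M) D \<le> 0"
    using popular_closed_sum_le[OF M N] D by auto
  moreover have "sum (ballot G N M) (vertices - D) + sum (ballot G N M) D = 0"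
    using sum.subset_diff[OF D(1) finite_vertices, of "ballot G N M"] phi_diff[of N M] eq by simp
  ultimately show ?thesis by linarith
qed

text \<open>This serves climbs, where no rival matching is given: \<open>F\<close> enters, and every
  edge of \<open>M\<close> meeting \<open>F\<close> is dropped. Only vertices of \<open>S\<close>
  can lose their partner; as none of them is critical, the result is feasible, and popularity lets
  the gain at most balance the lost votes.\<close>

lemma popular_exchange_le:
  assumes M: "popular_feasible G C M" and C: "C \<subseteq> men G"
    and F: "matching G F" "F \<inter> M = {}"
    and S: "finite S" "S \<inter> C = {}"
    and dropped_women: "\<And>m w. (m, w) \<in> M \<Longrightarrow> m \<in> fst ` F \<Longrightarrow> w \<in> snd ` F \<union> S"
    and dropped_men: "\<And>m w. (m, w) \<in> M \<Longrightarrow> w \<in> snd ` F \<Longrightarrow> m \<in> fst ` F \<union> S"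
  shows "2 * sum (gain G M) F \<le> int (card S)"
proof -
  let ?K = "{e \<in> M. fst e \<notin> fst ` F \<and> snd e \<notin> snd ` F}"
  let ?N = "F \<union> ?K"
  have mM: "matching G M" and feas: "\<forall>c\<in>C. matched M c"
    using M by (auto simp: popular_feasible_def feasible_def)
  have ME: "M \<subseteq> men G \<times> women G" using mM edges_subset by (auto simp: matching_def)
  have in_F: "m \<in> fst ` F" "w \<in> snd ` F" if "(m, w) \<in> F" for m w
    using that by force+
  have mN: "matching G ?N"
  proof (rule matchingI)
    show "?N \<subseteq> edges G" using mM F(1) by (auto simp: matching_def)
  next
    fix m w w' assume "(m, w) \<in> ?N" "(m, w') \<in> ?N"
    then show "w = w'"
      using in_F by (auto dest: matching_unique_woman[OF mM] matching_unique_woman[OF F(1)])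
  next
    fix m m' w assume "(m, w) \<in> ?N" "(m', w) \<in> ?N"
    then show "m = m'"
      using in_F by (auto dest: matching_unique_man[OF mM] matching_unique_man[OF F(1)])
  qed
  have lost: "u \<in> S" if "matched M u" "\<not> matched ?N u" for u
  proof -
    have nF: "u \<notin> fst ` F" "u \<notin> snd ` F" using that(2) by (auto simp: matched_def joined_def)
    from that(1) obtain v where "(u, v) \<in> M \<or> (v, u) \<in> M" by (auto simp: matched_def joined_def)
    then show ?thesis
    proof
      assume uv: "(u, v) \<in> M"
      then have "(u, v) \<notin> ?K" using that(2) by (auto simp: matched_def joined_def)
      then have "v \<in> snd ` F" using uv nF by simp
      then show ?thesis using dropped_men[OF uv] nF by blast
    next
      assume vu: "(v, u) \<in> M"
      then have "(v, u) \<notin> ?K" using that(2) by (auto simp: matched_def joined_def)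
      then have "v \<in> fst ` F" using vu nF by simp
      then show ?thesis using dropped_women[OF vu] nF by blast
    qed
  qed
  have feasN: "feasible G C ?N"
    using mN feas lost S(2) by (auto simp: feasible_def)
  have cl: "closed_under (M \<union> ?N) vertices"
    using ME mN edges_subset by (auto simp: closed_under_def matching_def)
  have "{e \<in> ?N - M. fst e \<in> vertices} = F"
    using F edges_subset by (auto simp: matching_def)
  then have "2 * sum (gain G M) F =
      sum (ballot G ?N M) vertices + int (card {u \<in> vertices. matched M u \<and> \<not> matched ?N u})"
    using sum_ballot_closed[OF mM mN order_refl cl] by simp
  also have "\<dots> \<le> 0 + int (card S)"
    using popular_closed_sum_le[OF M feasN order_refl cl] lost S(1)
    by (intro add_mono) (auto intro!: card_mono)
  finally show ?thesis by simp
qed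

end

section \<open>A component of two matchings laid out as a path\<close>

text \<open>The chain \<open>w 0, m 0, w 1, ..., w k, m k\<close> starts and ends with an edge of
  \<open>X\<close>, and \<open>Y\<close> covers neither end. The roles stay open because
  \<open>M\<close> is \<open>X\<close> for the SRAP and \<open>Y\<close> for the SIAP.\<close>

locale zigzag = marriage G for G :: "'v marriage" +
  fixes X Y :: "('v \<times> 'v) set" and m w :: "nat \<Rightarrow> 'v" and k :: nat
  assumes X: "matching G X" and Y: "matching G Y"
    and X_edge: "i \<le> k \<Longrightarrow> (m i, w i) \<in> X"
    and Y_edge: "i < k \<Longrightarrow> (m i, w (Suc i)) \<in> Y"
    and inj_m: "inj_on m {..k}" and inj_w: "inj_on w {..k}"
    and w_0: "w 0 \<notin> snd ` Y" and m_k: "m k \<notin> fst ` Y"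
begin

definition path :: "'v list" where
  "path = map (\<lambda>i. if even i then w (i div 2) else m (i div 2)) [0..<2 * Suc k]"

lemma length_path: "length path = 2 * Suc k"
  by (simp add: path_def)

lemma nth_path:
  shows "i \<le> k \<Longrightarrow> path ! (2 * i) = w i" and "i \<le> k \<Longrightarrow> path ! Suc (2 * i) = m i"
proof -
  assume "i \<le> k"
  then have "2 * i < 2 * Suc k" "Suc (2 * i) < 2 * Suc k" by simp_all
  then show "path ! (2 * i) = w i" "path ! Suc (2 * i) = m i"
    by (simp_all add: path_def del: upt_Suc mult_Suc_right)
qed

lemma path_step_cases:
  assumes "Suc i < length path"
  obtains (vertical) a where "i = 2 * a" "a \<le> k" "path ! i = w a" "path ! Suc i = m a"
  | (slanted) a where "i = Suc (2 * a)" "a < k" "path ! i = m a" "path ! Suc i = w (Suc a)"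
proof (cases "even i")
  case True
  then obtain a where "i = 2 * a" by (auto elim: evenE)
  then show ?thesis using assms nth_path[of a] vertical[of a] by (simp add: length_path)
next
  case False
  then obtain a where a: "i = Suc (2 * a)" by (auto elim: oddE)
  then have "a < k" using assms by (simp add: length_path)
  then show ?thesis using a nth_path(2)[of a] nth_path(1)[of "Suc a"] slanted[of a] by simp
qed

lemma m_man: "i \<le> k \<Longrightarrow> m i \<in> men G" and w_woman: "i \<le> k \<Longrightarrow> w i \<in> women G"
  using X X_edge edge_man edge_woman unfolding matching_def by blast+

lemma m_neq_w: "i \<le> k \<Longrightarrow> j \<le> k \<Longrightarrow> m i \<noteq> w j"
  using m_man w_woman not_man_and_woman by metis

lemma set_path: "set path = m ` {..k} \<union> w ` {..k}"
proof
  show "set path \<subseteq> m ` {..k} \<union> w ` {..k}"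
    unfolding path_def by auto
  have "m i \<in> set path" "w i \<in> set path" if "i \<le> k" for i
    using nth_path[OF that] nth_mem[of "2 * i" path] nth_mem[of "Suc (2 * i)" path] that
    by (simp_all add: length_path)
  then show "m ` {..k} \<union> w ` {..k} \<subseteq> set path" by auto
qed

lemma path_subset_vertices: "set path \<subseteq> vertices"
  using m_man w_woman by (auto simp: set_path)

lemma m_in_path: "i \<le> k \<Longrightarrow> m i \<in> set path" and w_in_path: "i \<le> k \<Longrightarrow> w i \<in> set path"
  by (auto simp: set_path)

lemma man_in_path: "a \<in> men G \<Longrightarrow> a \<in> set path \<Longrightarrow> \<exists>i\<le>k. a = m i"
  using w_woman not_man_and_woman by (auto simp: set_path)

lemma woman_in_path: "b \<in> women G \<Longrightarrow> b \<in> set path \<Longrightarrow> \<exists>i\<le>k. b = w i"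
  using m_man not_man_and_woman by (auto simp: set_path)

lemma hd_path: "hd path = w 0"
  using nth_path(1)[of 0] length_path by (simp add: hd_conv_nth flip: length_greater_0_conv)

lemma last_path: "last path = m k"
  using nth_path(2)[of k] length_path by (simp add: last_conv_nth flip: length_greater_0_conv)

lemma distinct_path: "distinct path"
proof -
  have "card (set path) = card (m ` {..k}) + card (w ` {..k})"
    unfolding set_path using m_neq_w by (intro card_Un_disjoint) auto
  also have "\<dots> = length path"
    by (simp add: card_image inj_m inj_w length_path)
  finally show ?thesis by (rule card_distinct)
qed

text \<open>The chain cannot be left: inner vertices have both their partners on it, and the two
  ends have no \<open>Y\<close>-partner. So it is a whole component, to which the local form of
  popularity applies.\<close>

lemma closed_path: "closed_under (X \<union> Y) (set path)"
proof -
  have XE: "a \<in> men G" "b \<in> women G" if "(a, b) \<in> X \<union> Y" for a b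
    using that X Y edges_subset by (auto simp: matching_def)
  have "a \<in> set path \<longleftrightarrow> b \<in> set path" if ab: "(a, b) \<in> X \<union> Y" for a b
  proof
    assume "a \<in> set path"
    with XE(1)[OF ab] obtain i where i: "i \<le> k" "a = m i" using man_in_path by blast
    show "b \<in> set path"
    proof (cases "(a, b) \<in> X")
      case True
      then have "b = w i" using matching_unique_woman[OF X] X_edge i by blast
      then show ?thesis using i w_in_path by simp
    next
      case False
      then have b: "(m i, b) \<in> Y" using ab i by simp
      then have "m i \<in> fst ` Y" by force
      then have "i < k" using m_k i by (metis le_neq_implies_less)
      then have "b = w (Suc i)" using matching_unique_woman[OF Y b Y_edge] by simp
      then show ?thesis using \<open>i < k\<close> w_in_path by simp
    qed
  next
    assume "b \<in> set path"
    with XE(2)[OF ab] obtain i where i: "i \<le> k" "b = w i" using woman_in_path by blast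
    show "a \<in> set path"
    proof (cases "(a, b) \<in> X")
      case True
      then have "a = m i" using matching_unique_man[OF X] X_edge i by blast
      then show ?thesis using i m_in_path by simp
    next
      case False
      then have a: "(a, w i) \<in> Y" using ab i by simp
      then have "w i \<in> snd ` Y" by force
      then obtain j where j: "i = Suc j" using w_0 by (cases i) auto
      then have "a = m j" using matching_unique_man[OF Y _ Y_edge] a i by simp
      then show ?thesis using j i m_in_path by simp
    qed
  qed
  then show ?thesis by (auto simp: closed_under_def)
qed

text \<open>Links the two ways of counting: labels are counted over edges of the path, ballots over
  edges whose man lies in a closed set.\<close>

lemma path_edges_path: "path_edges G path = {e \<in> X \<union> Y. fst e \<in> set path}"
proof (intro set_eqI iffI)
  fix e assume "e \<in> path_edges G path"
  then obtain i where e: "e \<in> edges G" "Suc i < length path"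
    "e = (path ! i, path ! Suc i) \<or> e = (path ! Suc i, path ! i)"
    by (auto simp: path_edges_def)
  then have man: "fst e \<in> men G" and woman: "snd e \<in> women G" using edges_subset by auto
  from e(2) show "e \<in> {e \<in> X \<union> Y. fst e \<in> set path}"
  proof (cases rule: path_step_cases)
    case (vertical a)
    then have "e = (m a, w a)" using e(3) man w_woman[of a] not_man_and_woman by auto
    then show ?thesis using X_edge m_in_path vertical by simp
  next
    case (slanted a)
    then have "e = (m a, w (Suc a))" using e(3) man w_woman[of "Suc a"] not_man_and_woman by auto
    then show ?thesis using Y_edge m_in_path slanted by simp
  qed
next
  fix e assume "e \<in> {e \<in> X \<union> Y. fst e \<in> set path}"
  then have e: "e \<in> X \<union> Y" "fst e \<in> set path" by auto
  then have eE: "e \<in> edges G" using X Y by (auto simp: matching_def)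
  then have "fst e \<in> men G" using edges_subset by auto
  then obtain i where i: "i \<le> k" "fst e = m i" using man_in_path e(2) by blast
  show "e \<in> path_edges G path"
  proof (cases "e \<in> X")
    case True
    then have "snd e = w i"
      using matching_unique_woman[OF X _ X_edge[OF i(1)]] i(2) by (metis prod.collapse)
    then have "e = (path ! Suc (2 * i), path ! (2 * i))"
      using i nth_path by (simp add: prod_eq_iff)
    then show ?thesis
      using eE i(1) length_path by (auto simp: path_edges_def intro!: exI[of _ "2 * i"])
  next
    case False
    then have eY: "(m i, snd e) \<in> Y" using e(1) i(2) by (metis UnE prod.collapse)
    then have "m i \<in> fst ` Y" by force
    then have ik: "i < k" using m_k i(1) by (metis le_neq_implies_less)
    then have "snd e = w (Suc i)" using matching_unique_woman[OF Y eY Y_edge] by simp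
    then have "e = (path ! Suc (2 * i), path ! Suc (Suc (2 * i)))"
      using i ik nth_path(2)[of i] nth_path(1)[of "Suc i"] by (simp add: prod_eq_iff)
    then show ?thesis
      using eE ik length_path by (auto simp: path_edges_def intro!: exI[of _ "Suc (2 * i)"])
  qed
qed

lemma X_edge_notin_Y: "i \<le> k \<Longrightarrow> (m i, w i) \<notin> Y"
proof
  assume i: "i \<le> k" and e: "(m i, w i) \<in> Y"
  then have "m i \<in> fst ` Y" by force
  then have "i < k" using m_k i by (metis le_neq_implies_less)
  then have "w i = w (Suc i)" using matching_unique_woman[OF Y e Y_edge] by simp
  then show False using inj_onD[OF inj_w, of i "Suc i"] \<open>i < k\<close> by simp
qed

lemma Y_edge_notin_X: "i < k \<Longrightarrow> (m i, w (Suc i)) \<notin> X"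
proof
  assume i: "i < k" and e: "(m i, w (Suc i)) \<in> X"
  then have "w (Suc i) = w i" using matching_unique_woman[OF X e X_edge] by simp
  then show False using inj_onD[OF inj_w, of i "Suc i"] i by simp
qed

lemma joined_iff:
  assumes "F \<subseteq> edges G" "i \<le> k" "j \<le> k"
  shows "joined F (m i) (w j) \<longleftrightarrow> (m i, w j) \<in> F" "joined F (w j) (m i) \<longleftrightarrow> (m i, w j) \<in> F"
proof -
  have "(w j, m i) \<notin> F" using assms edge_man w_woman not_man_and_woman by blast
  then show "joined F (m i) (w j) \<longleftrightarrow> (m i, w j) \<in> F" "joined F (w j) (m i) \<longleftrightarrow> (m i, w j) \<in> F"
    by (auto simp: joined_def)
qed

lemma alternating_path_path:
  assumes "M \<in> {X, Y}"
  shows "alternating_path G M path"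
proof -
  have ME: "M \<subseteq> edges G" using assms X Y by (auto simp: matching_def)
  have XE: "X \<subseteq> edges G" "Y \<subseteq> edges G" using X Y by (auto simp: matching_def)
  have adj: "joined (edges G) (path ! i) (path ! Suc i)" if "Suc i < length path" for i
    using that
  proof (cases rule: path_step_cases)
    case (vertical a)
    then show ?thesis using joined_iff(2)[of "edges G" a a] X_edge XE by auto
  next
    case (slanted a)
    then show ?thesis using joined_iff(1)[of "edges G" a "Suc a"] Y_edge XE by auto
  qed
  \<comment> \<open>Edges of \<open>X\<close> sit at even positions and edges of \<open>Y\<close> at
    odd ones, so membership in \<open>M\<close> flips from each position to the next.\<close>
  have alt: "joined M (path ! i) (path ! Suc i) \<longleftrightarrow> even i = (M = X)" if "Suc i < length path" for i
  proof -
    have M: "M = X \<or> M = Y \<and> M \<noteq> X" using assms by auto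
    from that show ?thesis
    proof (cases rule: path_step_cases)
      case (vertical a)
      then show ?thesis using joined_iff(2)[OF ME, of a a] X_edge[of a] X_edge_notin_Y[of a] M by auto
    next
      case (slanted a)
      then show ?thesis
        using joined_iff(1)[OF ME, of a "Suc a"] Y_edge[of a] Y_edge_notin_X[of a] M by auto
    qed
  qed
  show ?thesis
    unfolding alternating_path_def
    using path_subset_vertices distinct_path adj alt length_path by auto
qed

lemma not_matched_w_0: "\<not> matched Y (w 0)"
proof
  assume "matched Y (w 0)"
  then obtain v where "(w 0, v) \<in> Y \<or> (v, w 0) \<in> Y" by (auto simp: matched_def joined_def)
  then show False
  proof
    assume "(w 0, v) \<in> Y"
    then have "w 0 \<in> men G" using Y edge_man unfolding matching_def by blast
    then show False using w_woman[of 0] not_man_and_woman by simp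
  next
    assume "(v, w 0) \<in> Y"
    then show False using w_0 by force
  qed
qed

lemma not_matched_m_k: "\<not> matched Y (m k)"
proof
  assume "matched Y (m k)"
  then obtain v where "(m k, v) \<in> Y \<or> (v, m k) \<in> Y" by (auto simp: matched_def joined_def)
  then show False
  proof
    assume "(v, m k) \<in> Y"
    then have "m k \<in> women G" using Y edge_woman unfolding matching_def by blast
    then show False using m_man[of k] not_man_and_woman by simp
  next
    assume "(m k, v) \<in> Y"
    then show False using m_k by force
  qed
qed

lemma matched_X: "u \<in> set path \<Longrightarrow> matched X u"
  using X_edge by (fastforce simp: set_path matched_def joined_def)

text \<open>All inner vertices are covered by \<open>Y\<close>. When \<open>X\<close> is
  \<open>M\<close>, the two ends are the lost votes that force one surplus (+1,+1) edge.\<close>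

lemma lost_in_path: "{u \<in> set path. matched X u \<and> \<not> matched Y u} = {w 0, m k}"
proof -
  have "matched Y (m i)" if "i < k" for i
    using Y_edge[OF that] by (auto simp: matched_def joined_def)
  moreover have "matched Y (w i)" if "0 < i" "i \<le> k" for i
    using Y_edge[of "i - 1"] that unfolding matched_def joined_def by (cases i) auto
  ultimately have "u = w 0 \<or> u = m k" if u: "u \<in> set path" "\<not> matched Y u" for u
  proof -
    from u(1) consider i where "i \<le> k" "u = m i" | i where "i \<le> k" "u = w i"
      unfolding set_path by blast
    then show ?thesis
    proof cases
      case 1
      then show ?thesis using u(2) \<open>\<And>i. i < k \<Longrightarrow> matched Y (m i)\<close>[of i] by (cases "i = k") auto
    next
      case 2
      then show ?thesis
        using u(2) \<open>\<And>i. 0 < i \<Longrightarrow> i \<le> k \<Longrightarrow> matched Y (w i)\<close>[of i] by (cases "i = 0") auto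
    qed
  qed
  then show ?thesis
    using not_matched_w_0 not_matched_m_k matched_X m_in_path w_in_path by auto
qed

text \<open>In a tie the ballots on the component sum to 0, so twice its gain equals the number of
  lost partners: 2 if \<open>M\<close> is \<open>X\<close> and 0 if \<open>M\<close> is
  \<open>Y\<close>. One statement thus covers both kinds of path.\<close>

lemma num_label_path:
  assumes M: "popular_feasible G C M" and N: "feasible G C N" and eq: "phi G N M = phi G M N"
    and MN: "{M, N} = {X, Y}"
  shows "2 * (int (num_label G M path (1, 1)) - int (num_label G M path (-1, -1))) =
    int (card {u \<in> set path. matched M u \<and> \<not> matched N u})"
proof -
  have mM: "matching G M" and mN: "matching G N"
    using M N by (auto simp: popular_feasible_def feasible_def)
  have un: "M \<union> N = X \<union> Y" using MN by (metis Un_commute doubleton_eq_iff)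
  then have cl: "closed_under (M \<union> N) (set path)" using closed_path by simp
  have E: "path_edges G path - M = {e \<in> N - M. fst e \<in> set path}"
    unfolding path_edges_path un[symmetric] by auto
  have "finite (path_edges G path - M)"
    unfolding E using finite_matching[OF mN] by simp
  then show ?thesis
    using sum_ballot_closed[OF mM mN path_subset_vertices cl] num_label_diff[of G path M]
      popular_closed_sum_eq_0[OF M N eq path_subset_vertices cl] E by simp
qed

end

lemma (in marriage) zigzag_exists:
  assumes X: "matching G X" and Y: "matching G Y" and "card Y < card X"
  shows "\<exists>m w k. zigzag G X Y m w k"
proof -
  have "inj_on fst X" "inj_on snd X" "inj_on fst Y" "inj_on snd Y"
    using X Y by (auto simp: matching_def)
  from exists_chain[OF finite_matching[OF X] finite_matching[OF Y] this assms(3)]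
  obtain k m w where "\<forall>i\<le>k. (m i, w i) \<in> X" "\<forall>i<k. (m i, w (Suc i)) \<in> Y"
    "inj_on m {..k}" "inj_on w {..k}" "w 0 \<notin> snd ` Y" "m k \<notin> fst ` Y"
    by (elim exE conjE) (rule that)
  then have "zigzag G X Y m w k"
    using X Y by unfold_locales auto
  then show ?thesis by blast
qed

section \<open>Climbs and the bounds that popularity puts on their height\<close>

locale popular_marriage = marriage G for G :: "'v marriage" +
  fixes C :: "'v set" and M :: "('v \<times> 'v) set"
  assumes critical: "C \<subseteq> men G" and popular: "popular_feasible G C M"
begin

lemma matching_M: "matching G M"
  using popular by (simp add: popular_feasible_def feasible_def)

lemma M_man: "(a, b) \<in> M \<Longrightarrow> a \<in> men G" and M_woman: "(a, b) \<in> M \<Longrightarrow> b \<in> women G"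
  using matching_M edge_man edge_woman unfolding matching_def by blast+

text \<open>The edges outside \<open>M\<close> of an alternating path, directed from men to women:
  the woman of each edge is the \<open>M\<close>-partner of the man of the next one.\<close>
definition climb :: "('v \<times> 'v) list \<Rightarrow> bool" where
  "climb L \<longleftrightarrow> L \<noteq> [] \<and> set L \<subseteq> edges G - M \<and> distinct (map fst L) \<and> distinct (map snd L) \<and>
     successively (\<lambda>e f. (fst f, snd e) \<in> M) L"

definition height :: "('v \<times> 'v) list \<Rightarrow> int" where
  "height L = sum_list (map (gain G M) L)"

lemma height_simps [simp]:
  "height [] = 0" "height (e # L) = gain G M e + height L" "height (L @ L') = height L + height L'"
  by (simp_all add: height_def)

lemma height_eq_sum: "climb L \<Longrightarrow> height L = sum (gain G M) (set L)"
  by (simp add: climb_def height_def distinct_map sum_list_distinct_conv_sum_set)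

lemma climb_matching: "climb L \<Longrightarrow> matching G (set L)"
  by (auto simp: climb_def matching_def distinct_map)

text \<open>Provides the uniform bound on levels on which termination rests.\<close>

lemma height_le_card_edges:
  assumes "climb L"
  shows "height L \<le> int (card (edges G))"
proof -
  have "height L \<le> (\<Sum>e\<in>set L. 1)"
    unfolding height_eq_sum[OF assms] by (intro sum_mono gain_le_1)
  also have "\<dots> \<le> int (card (edges G))"
    using assms finite_edges by (auto simp: climb_def intro!: card_mono)
  finally show ?thesis .
qed

text \<open>The partner of each woman but the last is the man of the next edge, so an exchange along
  the climb can deprive no man except the partner of the last woman.\<close>

lemma partner_of_climb_woman:
  assumes "successively (\<lambda>e f. (fst f, snd e) \<in> M) L" "(a, b) \<in> M" "b \<in> snd ` set L"
  shows "a \<in> fst ` set L \<or> b = snd (last L)"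
  using assms
proof (induction L rule: induct_list012)
  case (3 e f L)
  then have f: "(fst f, snd e) \<in> M" by simp
  show ?case
  proof (cases "b = snd e")
    case True
    then have "a = fst f" using matching_unique_man[OF matching_M] "3.prems"(2) f by blast
    then show ?thesis by simp
  next
    case False
    have "b \<in> snd ` set (f # L)" using "3.prems"(3) False by simp
    moreover have "successively (\<lambda>e f. (fst f, snd e) \<in> M) (f # L)" using "3.prems"(1) by simp
    ultimately have "a \<in> fst ` set (f # L) \<or> b = snd (last (f # L))"
      using "3.IH"(2) "3.prems"(2) by blast
    then show ?thesis by auto
  qed
qed auto

text \<open>The mirror image for men, with the first man as the exception. The sharper
  \<open>butlast\<close> is what later shows that the partner of the last woman is not itself on the
  climb.\<close>

lemma partner_of_climb_man:
  assumes "successively (\<lambda>e f. (fst f, snd e) \<in> M) L" "(a, b) \<in> M" "a \<in> fst ` set L"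
  shows "b \<in> snd ` set (butlast L) \<or> a = fst (hd L)"
  using assms
proof (induction L rule: induct_list012)
  case (3 e f L)
  then have f: "(fst f, snd e) \<in> M" by simp
  show ?case
  proof (cases "a = fst f")
    case True
    then have "b = snd e" using matching_unique_woman[OF matching_M] "3.prems"(2) f by blast
    then show ?thesis by simp
  next
    case False
    have "a = fst e \<or> a \<in> fst ` set (f # L)" using "3.prems"(3) by simp
    moreover have "successively (\<lambda>e f. (fst f, snd e) \<in> M) (f # L)" using "3.prems"(1) by simp
    note "3.IH"(2)[OF this "3.prems"(2)]
    ultimately have "a = fst e \<or> b \<in> snd ` set (butlast (f # L))"
      using False by (metis list.sel(1))
    moreover have "butlast (e # f # L) = e # butlast (f # L)" by simp
    ultimately show ?thesis by (metis image_insert insertCI list.sel(1) list.set(2))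
  qed
qed auto

text \<open>The closing edge of \<open>M\<close> makes the climb an alternating cycle. Exchanging
  along it deprives nobody of a partner, so a positive gain would beat \<open>M\<close>.\<close>

lemma climb_cycle_le_0:
  assumes L: "climb L" and cyc: "(fst (hd L), snd (last L)) \<in> M"
  shows "height L \<le> 0"
proof -
  have succ: "successively (\<lambda>e f. (fst f, snd e) \<in> M) L" and ne: "L \<noteq> []"
    using L by (auto simp: climb_def)
  have "2 * sum (gain G M) (set L) \<le> int (card ({} :: 'v set))"
  proof (rule popular_exchange_le[OF popular critical climb_matching[OF L]])
    show "set L \<inter> M = {}" using L by (auto simp: climb_def)
  next
    fix a b assume ab: "(a, b) \<in> M" "a \<in> fst ` set L"
    have "a = fst (hd L) \<Longrightarrow> b = snd (last L)"
      using matching_unique_woman[OF matching_M ab(1)] cyc by blast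
    then show "b \<in> snd ` set L \<union> {}"
      using partner_of_climb_man[OF succ ab] ne by (auto dest: in_set_butlastD)
  next
    fix a b assume ab: "(a, b) \<in> M" "b \<in> snd ` set L"
    have "b = snd (last L) \<Longrightarrow> a = fst (hd L)"
      using matching_unique_man[OF matching_M _ cyc] ab(1) by blast
    then show "a \<in> fst ` set L \<union> {}"
      using partner_of_climb_woman[OF succ ab] ne by auto
  qed simp_all
  then show ?thesis by (simp add: height_eq_sum[OF L])
qed

text \<open>The exchange can deprive only \<open>a\<close> and the partner of the first man. The
  latter is a woman and so not critical; two lost votes bound twice the height.\<close>

lemma climb_to_noncritical_le_1:
  assumes L: "climb L" and a: "(a, snd (last L)) \<in> M" "a \<notin> C"
  shows "height L \<le> 1"
proof -
  have succ: "successively (\<lambda>e f. (fst f, snd e) \<in> M) L" and ne: "L \<noteq> []"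
    using L by (auto simp: climb_def)
  \<comment> \<open>\<open>c\<close> is the partner of the first man. If he has none, the default is
    \<open>a\<close>, which is noncritical as well.\<close>
  obtain c where c: "c \<notin> C" "\<And>b. (fst (hd L), b) \<in> M \<Longrightarrow> b = c"
  proof (cases "\<exists>b. (fst (hd L), b) \<in> M")
    case True
    then obtain b where b: "(fst (hd L), b) \<in> M" by blast
    then have "b \<notin> C" using M_woman critical not_man_and_woman by blast
    then show ?thesis using that b matching_unique_woman[OF matching_M] by blast
  next
    case False
    then show ?thesis using that a(2) by blast
  qed
  have "2 * sum (gain G M) (set L) \<le> int (card {a, c})"
  proof (rule popular_exchange_le[OF popular critical climb_matching[OF L]])
    show "set L \<inter> M = {}" using L by (auto simp: climb_def)
    show "{a, c} \<inter> C = {}" using a(2) c(1) by simp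
  next
    fix x b assume xb: "(x, b) \<in> M" "x \<in> fst ` set L"
    then show "b \<in> snd ` set L \<union> {a, c}"
      using partner_of_climb_man[OF succ xb] c(2) by (auto dest: in_set_butlastD)
  next
    fix x b assume xb: "(x, b) \<in> M" "b \<in> snd ` set L"
    have "b = snd (last L) \<Longrightarrow> x = a"
      using matching_unique_man[OF matching_M _ a(1)] xb(1) by blast
    then show "x \<in> fst ` set L \<union> {a, c}"
      using partner_of_climb_woman[OF succ xb] by auto
  qed simp_all
  also have "\<dots> \<le> 2" by (simp add: card_insert_if)
  finally show ?thesis by (simp add: height_eq_sum[OF L])
qed

section \<open>Climbs as certificates for levels\<close>

text \<open>Each positive level is witnessed by a climb to the vertex or to its partner. The height
  may exceed the level, because cutting a cycle off a climb can increase its height.\<close>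

definition level_invariant :: "('v \<Rightarrow> int) \<Rightarrow> bool" where
  "level_invariant lev \<longleftrightarrow> (\<forall>v. 0 \<le> lev v) \<and> (\<forall>(a, b) \<in> M. lev a = lev b) \<and>
     (\<forall>v. 0 < lev v \<longrightarrow>
       (\<exists>L. climb L \<and> (v = snd (last L) \<or> (v, snd (last L)) \<in> M) \<and> lev v \<le> height L))"

lemma level_invariant_0: "level_invariant (\<lambda>_. 0)"
  by (simp add: level_invariant_def split_beta)

lemma level_invariant_partner: "level_invariant lev \<Longrightarrow> (a, b) \<in> M \<Longrightarrow> lev a = lev b"
  by (auto simp: level_invariant_def)

lemma level_invariant_man:
  assumes "level_invariant lev" "a \<in> men G" "0 < lev a"
  obtains L where "climb L" "(a, snd (last L)) \<in> M" "lev a \<le> height L"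
proof -
  obtain L where L: "climb L" "a = snd (last L) \<or> (a, snd (last L)) \<in> M" "lev a \<le> height L"
    using assms by (auto simp: level_invariant_def)
  have "last L \<in> edges G" using L(1) last_in_set by (auto simp: climb_def)
  then have "snd (last L) \<in> women G" using edges_subset by auto
  then show ?thesis using that L assms(2) not_man_and_woman by blast
qed

lemma level_le_card_edges: "level_invariant lev \<Longrightarrow> lev v \<le> int (card (edges G))"
  by (metis height_le_card_edges level_invariant_def not_le of_nat_0_le_iff order_trans)

lemma noncritical_level_le_1:
  assumes "level_invariant lev" "a \<in> men G - C"
  shows "lev a \<le> 1"
proof (rule ccontr)
  assume "\<not> lev a \<le> 1"
  then obtain L where L: "climb L" "(a, snd (last L)) \<in> M" "lev a \<le> height L"
    using level_invariant_man[of lev a] assms by auto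
  then show False
    using climb_to_noncritical_le_1[OF L(1,2)] assms(2) \<open>\<not> lev a \<le> 1\<close> by auto
qed

text \<open>A prolonged climb that meets its own woman \<open>b\<close> is cut back at \<open>b\<close>: the part cut off is an
  alternating cycle, so by popularity the height does not decrease.\<close>
lemma climb_extend:
  assumes inv: "level_invariant lev" and ab: "(a, b) \<in> edges G - M"
    and up: "lev b < lev a + gain G M (a, b)"
  shows "\<exists>L. climb L \<and> snd (last L) = b \<and> lev a + gain G M (a, b) \<le> height L"
proof (cases "0 < lev a")
  case False
  moreover have "0 \<le> lev a" using inv by (simp add: level_invariant_def)
  ultimately have "lev a = 0" by simp
  then show ?thesis using ab by (intro exI[of _ "[(a, b)]"]) (simp add: climb_def)
next
  case True
  have "a \<in> men G" using ab edge_man by blast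
  then obtain L where L: "climb L" "(a, snd (last L)) \<in> M" "lev a \<le> height L"
    using level_invariant_man[OF inv _ True] by blast
  have succ: "successively (\<lambda>e f. (fst f, snd e) \<in> M) L" and ne: "L \<noteq> []"
    and dist: "distinct (map fst L)" "distinct (map snd L)" and sub: "set L \<subseteq> edges G - M"
    using L(1) by (auto simp: climb_def)
  \<comment> \<open>Otherwise \<open>L\<close> would close up to a cycle of height at least
    \<open>lev a\<close>, which is positive.\<close>
  have "a \<noteq> fst (hd L)"
    using climb_cycle_le_0[OF L(1)] L(2,3) True by auto
  moreover have "snd (last L) \<notin> snd ` set (butlast L)"
  proof -
    have "map snd L = map snd (butlast L) @ [snd (last L)]"
      using arg_cong[OF append_butlast_last_id[OF ne], of "map snd"] by simp
    then show ?thesis using dist(2) by simp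
  qed
  ultimately have a: "a \<notin> fst ` set L"
    using partner_of_climb_man[OF succ L(2)] by blast
  show ?thesis
  proof (cases "b \<in> snd ` set L")
    case False
    have "climb (L @ [(a, b)])"
      unfolding climb_def using sub ab dist a False succ ne L(2)
      by (auto simp: successively_append_iff)
    then show ?thesis using L(3) by (intro exI[of _ "L @ [(a, b)]"]) simp
  next
    case True
    then obtain e where "e \<in> set L" and e: "snd e = b" by blast
    then obtain P Q where PQ: "L = P @ e # Q" by (meson split_list)
    have "b \<noteq> snd (last L)" using L(2) ab by blast
    then have Q: "Q \<noteq> []" using PQ e by auto
    have P: "climb (P @ [e])"
      using sub dist succ unfolding PQ climb_def by (auto simp: successively_append_iff)
    have Q_succ: "(fst (hd Q), b) \<in> M" "successively (\<lambda>e f. (fst f, snd e) \<in> M) Q"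
      using succ Q unfolding PQ e[symmetric] by (cases Q; auto simp: successively_append_iff)+
    have "last L = last Q" using PQ Q by simp
    then have "climb (Q @ [(a, b)])"
      using sub ab dist a Q_succ(2) L(2) Q e unfolding PQ climb_def
      by (auto simp: successively_append_iff)
    moreover have "(fst (hd (Q @ [(a, b)])), snd (last (Q @ [(a, b)]))) \<in> M"
      using Q_succ(1) Q by simp
    ultimately have "height (Q @ [(a, b)]) \<le> 0" by (rule climb_cycle_le_0)
    \<comment> \<open>The height of \<open>L\<close> is that of \<open>P @ [e]\<close> plus that of
      \<open>Q\<close>, and the latter together with the gain of \<open>(a, b)\<close> is at most
      0.\<close>
    then have "lev a + gain G M (a, b) \<le> height (P @ [e])"
      using L(3) unfolding PQ by simp
    then show ?thesis using P e by (intro exI[of _ "P @ [e]"]) simp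
  qed
qed

lemma joined_woman_iff: "b \<in> women G \<Longrightarrow> joined M b v \<longleftrightarrow> (v, b) \<in> M"
  using M_man not_man_and_woman unfolding joined_def by blast

text \<open>The new level of \<open>b\<close> and of its partner is certified by the extended climb;
  all other certificates stay valid. The two monotonicity claims feed the termination
  measure.\<close>

lemma raise_invariant:
  assumes inv: "level_invariant lev" and r: "raise G M lev lev'"
  shows "level_invariant lev'" and "\<forall>v. lev v \<le> lev' v" and "\<exists>b \<in> vertices. lev b < lev' b"
proof -
  obtain a b where ab: "(a, b) \<in> edges G - M" "lev b < lev a + gain G M (a, b)"
    and lev': "lev' = set_level M b (lev a + gain G M (a, b)) lev"
    using r unfolding raise_def by blast
  let ?k = "lev a + gain G M (a, b)"
  have b: "b \<in> women G" using ab edge_woman by blast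
  have lev'_eq: "lev' v = (if v = b \<or> (v, b) \<in> M then ?k else lev v)" for v
    by (simp add: lev' set_level_def joined_woman_iff[OF b])
  have lev_b: "lev v = lev b" if "v = b \<or> (v, b) \<in> M" for v
    using that by (auto dest: level_invariant_partner[OF inv])
  show le: "\<forall>v. lev v \<le> lev' v"
  proof
    show "lev v \<le> lev' v" for v
      using lev_b[of v] ab(2) by (auto simp: lev'_eq)
  qed
  show "\<exists>b \<in> vertices. lev b < lev' b"
    using b ab(2) by (intro bexI[of _ b]) (simp_all add: lev'_eq)
  obtain L where L: "climb L" "snd (last L) = b" "?k \<le> height L"
    using climb_extend[OF inv ab] by blast
  show "level_invariant lev'"
    unfolding level_invariant_def
  proof (intro conjI allI impI)
    fix v
    have "0 \<le> lev v" using inv by (simp add: level_invariant_def)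
    then show "0 \<le> lev' v" using le order_trans by blast
  next
    have "lev' x = lev' y" if xy: "(x, y) \<in> M" for x y
    proof -
      have "x \<noteq> b" "(y, b) \<notin> M"
        using xy b M_man M_woman not_man_and_woman by blast+
      moreover have "(x, b) \<in> M \<longleftrightarrow> y = b"
        using xy matching_unique_woman[OF matching_M] by blast
      ultimately show ?thesis
        using level_invariant_partner[OF inv xy] by (simp add: lev'_eq)
    qed
    then show "\<forall>(x, y) \<in> M. lev' x = lev' y" by blast
  next
    fix v assume pos: "0 < lev' v"
    show "\<exists>L. climb L \<and> (v = snd (last L) \<or> (v, snd (last L)) \<in> M) \<and> lev' v \<le> height L"
    proof (cases "v = b \<or> (v, b) \<in> M")
      case True
      then show ?thesis using L by (intro exI[of _ L]) (simp add: lev'_eq)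
    next
      case False
      then have "lev' v = lev v" by (simp add: lev'_eq)
      then show ?thesis using inv pos by (simp add: level_invariant_def)
    qed
  qed
qed

section \<open>Termination of the leveling procedure and its final inequalities\<close>

text \<open>Under the invariant no level exceeds the number of edges, so \<open>nat\<close>
  truncates nothing.\<close>

definition deficit :: "('v \<Rightarrow> int) \<Rightarrow> nat" where
  "deficit lev = nat (\<Sum>v\<in>vertices. int (card (edges G)) - lev v)"

lemma raise_deficit:
  assumes inv: "level_invariant lev" and r: "raise G M lev lev'"
  shows "level_invariant lev' \<and> deficit lev' < deficit lev"
proof
  note * = raise_invariant[OF inv r]
  show "level_invariant lev'" by (rule *)
  let ?K = "int (card (edges G))"
  have "(\<Sum>v\<in>vertices. ?K - lev' v) < (\<Sum>v\<in>vertices. ?K - lev v)"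
    using * finite_vertices by (intro sum_strict_mono_ex1) auto
  moreover have "0 \<le> (\<Sum>v\<in>vertices. ?K - lev' v)"
    using level_le_card_edges[OF *(1)] by (intro sum_nonneg) simp
  ultimately show "deficit lev' < deficit lev" by (simp add: deficit_def)
qed

lemma step_deficit:
  assumes "level_invariant lev"
    and "step1 G M lev lev' \<or> step2 G M lev lev' \<or> step3 G M lev lev'"
  shows "level_invariant lev' \<and> deficit lev' < deficit lev"
  using raise_deficit[OF assms(1)] assms(2) by (simp add: raise_iff_step)

lemma while_run_invariant:
  assumes "while_run step s t" "level_invariant s"
    and "\<And>lev lev'. step lev lev' \<Longrightarrow> step1 G M lev lev' \<or> step2 G M lev lev' \<or> step3 G M lev lev'"
  shows "level_invariant t"
proof -
  have "step\<^sup>*\<^sup>* s t" using assms(1) by (simp add: while_run_def)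
  then show ?thesis
    using assms(2) by induction (use step_deficit assms(3) in blast)+
qed

lemma leveling_invariant:
  assumes "leveling G M lev"
  shows "level_invariant lev" and "\<not> raise G M lev lev'"
proof -
  have "(leveling_round G M)\<^sup>*\<^sup>* (\<lambda>_. 0) lev" using assms by (simp add: leveling_def)
  then show "level_invariant lev"
  proof induction
    case (step s t)
    then obtain u v where "while_run (step1 G M) s u" "while_run (step2 G M) u v"
      "while_run (step3 G M) v t" by (auto simp: leveling_round_def)
    then show ?case using step.IH while_run_invariant by blast
  qed (rule level_invariant_0)
  show "\<not> raise G M lev lev'"
    using assms by (auto simp: leveling_def while_run_def raise_iff_step)
qed

text \<open>A violated inequality would permit another relaxation. The final levels are thus a
  potential for the gains, ready to be telescoped along a path.\<close>

lemma leveling_edge: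
  assumes "leveling G M lev" "(a, b) \<in> edges G - M"
  shows "lev a + gain G M (a, b) \<le> lev b"
proof (rule ccontr)
  assume "\<not> lev a + gain G M (a, b) \<le> lev b"
  then have "raise G M lev (set_level M b (lev a + gain G M (a, b)) lev)"
    using assms(2) unfolding raise_def by force
  then show False using leveling_invariant(2)[OF assms(1)] by blast
qed

text \<open>A phase may be idle while a later one is not, so the decrease is claimed for the whole
  round: if the deficit stayed the same, all three phases would have been idle at \<open>s\<close>,
  and no relaxation would apply there.\<close>

lemma round_exists:
  assumes inv: "level_invariant s"
  shows "\<exists>t. leveling_round G M s t \<and> level_invariant t \<and> ((\<exists>u. raise G M s u) \<longrightarrow> deficit t < deficit s)"
proof -
  have run: "\<exists>t. while_run step s t \<and> level_invariant t \<and> deficit t \<le> deficit s \<and>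
      ((\<exists>u. step s u) \<longrightarrow> deficit t < deficit s)"
    if "level_invariant s" "step \<in> {step1 G M, step2 G M, step3 G M}" for s step
    using that by (intro while_run_exists[where P = level_invariant]) (use step_deficit in blast)+
  have idle: "t = s" if "while_run step s t" "\<not> (\<exists>u. step s u)" for step :: "('v \<Rightarrow> int) \<Rightarrow> _" and s t
    using that by (auto simp: while_run_def elim: converse_rtranclpE)
  from run[OF inv, of "step1 G M"] obtain t1 where
    t1: "while_run (step1 G M) s t1" "level_invariant t1" "deficit t1 \<le> deficit s"
      "(\<exists>u. step1 G M s u) \<longrightarrow> deficit t1 < deficit s" by auto
  from run[OF t1(2), of "step2 G M"] obtain t2 where
    t2: "while_run (step2 G M) t1 t2" "level_invariant t2" "deficit t2 \<le> deficit t1"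
      "(\<exists>u. step2 G M t1 u) \<longrightarrow> deficit t2 < deficit t1" by auto
  from run[OF t2(2), of "step3 G M"] obtain t3 where
    t3: "while_run (step3 G M) t2 t3" "level_invariant t3" "deficit t3 \<le> deficit t2"
      "(\<exists>u. step3 G M t2 u) \<longrightarrow> deficit t3 < deficit t2" by auto
  have "deficit t3 < deficit s" if "raise G M s u" for u
  proof (rule ccontr)
    assume "\<not> deficit t3 < deficit s"
    then have eq: "deficit t1 = deficit s" "deficit t2 = deficit t1" "deficit t3 = deficit t2"
      using t1(3) t2(3) t3(3) by linarith+
    then have "t1 = s" using idle[OF t1(1)] t1(4) by auto
    moreover have "t2 = t1" using idle[OF t2(1)] t2(4) eq by auto
    ultimately show False using that t1(4) t2(4) t3(4) eq by (auto simp: raise_iff_step)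
  qed
  then show ?thesis
    using t1(1) t2(1) t3(1,2) unfolding leveling_round_def by blast
qed

lemma leveling_exists: "\<exists>lev. leveling G M lev"
proof -
  have "\<exists>t. (leveling_round G M)\<^sup>*\<^sup>* s t \<and> \<not> (\<exists>u. raise G M t u)" if "level_invariant s" for s
    using that
  proof (induction "deficit s" arbitrary: s rule: less_induct)
    case less
    show ?case
    proof (cases "\<exists>u. raise G M s u")
      case True
      then obtain t where "leveling_round G M s t" "level_invariant t" "deficit t < deficit s"
        using round_exists[OF less.prems] by blast
      with less.hyps show ?thesis by (meson converse_rtranclp_into_rtranclp)
    qed blast
  qed
  then obtain t where "(leveling_round G M)\<^sup>*\<^sup>* (\<lambda>_. 0) t" "\<not> (\<exists>u. raise G M t u)"
    using level_invariant_0 by blast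
  then have "leveling G M t"
    by (auto simp: leveling_def while_run_def raise_iff_step)
  then show ?thesis by blast
qed

section \<open>The size reducing and the size increasing path\<close>

lemma SRAP_exists:
  assumes N: "feasible G C N" and eq: "phi G N M = phi G M N" and card: "card N < card M"
    and lev: "leveling G M lev"
  shows "\<exists>p. SRAP G C M lev p"
proof -
  have mN: "matching G N" using N by (simp add: feasible_def)
  obtain m w k where "zigzag G M N m w k"
    using zigzag_exists[OF matching_M mN card] by blast
  then interpret zigzag G M N m w k .
  note inv = leveling_invariant(1)[OF lev]
  have ends: "w 0 \<noteq> m k" using m_neq_w[of k 0] by simp
  have labels: "num_label G M path (1, 1) = num_label G M path (-1, -1) + 1"
    using num_label_path[OF popular N eq] lost_in_path ends by simp
  let ?E = "(\<lambda>i. (m i, w (Suc i))) ` {..<k}"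
  \<comment> \<open>Indexing the edges outside \<open>M\<close> by their position turns the gain of
    the path into a sum that can be telescoped.\<close>
  have "path_edges G path - M = ?E"
  proof
    show "?E \<subseteq> path_edges G path - M"
      using Y_edge Y_edge_notin_X m_in_path by (auto simp: path_edges_path)
    show "path_edges G path - M \<subseteq> ?E"
    proof
      fix e assume "e \<in> path_edges G path - M"
      then have e: "e \<in> N" "fst e \<in> set path" by (auto simp: path_edges_path)
      then have "fst e \<in> men G" using mN edges_subset by (auto simp: matching_def)
      then obtain i where i: "i \<le> k" "fst e = m i" using man_in_path e(2) by blast
      then have "i < k" using m_k e(1) by (metis image_eqI le_neq_implies_less)
      moreover have "snd e = w (Suc i)"
        using matching_unique_woman[OF mN _ Y_edge[OF \<open>i < k\<close>]] e(1) i(2) by (metis prod.collapse)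
      ultimately show "e \<in> ?E" using i(2) by (auto simp: prod_eq_iff)
    qed
  qed
  moreover have "inj_on (\<lambda>i. (m i, w (Suc i))) {..<k}"
    using inj_m by (auto simp: inj_on_def)
  ultimately have "1 = (\<Sum>i<k. gain G M (m i, w (Suc i)))"
    using num_label_diff[of G path M] labels by (simp add: sum.reindex)
  \<comment> \<open>The edge from \<open>m i\<close> to \<open>w (Suc i)\<close> starts at the level
    of \<open>w i\<close>, since \<open>m i\<close> and \<open>w i\<close> are partners in
    \<open>M\<close>.\<close>
  also have "\<dots> \<le> (\<Sum>i<k. lev (w (Suc i)) - lev (w i))"
  proof (rule sum_mono)
    fix i assume "i \<in> {..<k}"
    then have i: "i < k" by simp
    then have "(m i, w (Suc i)) \<in> edges G - M"
      using Y_edge Y_edge_notin_X mN by (auto simp: matching_def)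
    from leveling_edge[OF lev this] show "gain G M (m i, w (Suc i)) \<le> lev (w (Suc i)) - lev (w i)"
      using level_invariant_partner[OF inv X_edge[of i]] i by simp
  qed
  also have "\<dots> = lev (m k) - lev (w 0)"
    using level_invariant_partner[OF inv X_edge[of k]] sum_lessThan_telescope[of "\<lambda>i. lev (w i)" k]
    by simp
  finally have rise: "1 \<le> lev (m k) - lev (w 0)" .
  \<comment> \<open>The feasible matching \<open>N\<close> leaves \<open>m k\<close>
    unmatched.\<close>
  have "m k \<notin> C" using not_matched_m_k N by (auto simp: feasible_def)
  then have mk: "m k \<in> men G - C" using m_man by simp
  have "lev (m k) \<le> 1" by (rule noncritical_level_le_1[OF inv mk])
  moreover have "0 \<le> lev (w 0)" using inv by (simp add: level_invariant_def)
  ultimately have "lev (w 0) = 0" "lev (m k) = 1" using rise by linarith+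
  then have "SRAP G C M lev path"
    using labels mk w_woman[of 0] matched_X[OF w_in_path[of 0]] alternating_path_path[of M]
    by (simp add: SRAP_def hd_path last_path)
  then show ?thesis ..
qed

lemma SIAP_exists:
  assumes N: "feasible G C N" and eq: "phi G N M = phi G M N" and card: "card M < card N"
  shows "\<exists>p. SIAP G M p"
proof -
  have mN: "matching G N" using N by (simp add: feasible_def)
  obtain m w k where "zigzag G N M m w k"
    using zigzag_exists[OF mN matching_M card] by blast
  then interpret zigzag G N M m w k .
  \<comment> \<open>Here \<open>N\<close> is the larger matching and covers every vertex of the
    path, so nobody loses a partner and the two label counts agree.\<close>
  have "{u \<in> set path. matched M u \<and> \<not> matched N u} = {}" using matched_X by auto
  then have card_0: "card {u \<in> set path. matched M u \<and> \<not> matched N u} = 0"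
    by (simp only: card.empty)
  have tie: "2 * (int x - int y) = int 0 \<Longrightarrow> x = y" for x y
    by simp
  have "num_label G M path (1, 1) = num_label G M path (-1, -1)"
    by (rule tie, fold card_0, rule num_label_path[OF popular N eq insert_commute])
  then have "SIAP G M path"
    using m_man[of k] w_woman[of 0] not_matched_w_0 not_matched_m_k alternating_path_path[of M]
    by (simp add: SIAP_def hd_path last_path)
  then show ?thesis ..
qed

end

theorem mainTheorem9:
  fixes G :: "'v marriage" and C :: "'v set" and M :: "('v \<times> 'v) set"
  assumes "marriage_instance G"
    and "C \<subseteq> men G"
    and "popular_feasible G C M"
    and "\<not> min_size_popular_feasible G C M"
    and "\<not> dominant_feasible G C M"
  shows "(\<exists>lev. leveling G M lev) \<and>
         (\<forall>lev. leveling G M lev \<longrightarrow> (\<exists>p. SRAP G C M lev p)) \<and>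
         (\<exists>p. SIAP G M p)"
proof -
  interpret popular_marriage G C M
    using assms(1-3) by unfold_locales
  obtain N where N: "popular_feasible G C N" "card N < card M"
    using assms(3,4) by (auto simp: min_size_popular_feasible_def not_le)
  then have fN: "feasible G C N" by (simp add: popular_feasible_def)
  \<comment> \<open>Both matchings are popular, so each bounds the votes for the other and they
    tie.\<close>
  moreover have "phi G N M = phi G M N"
    using assms(3) N(1) by (auto simp: popular_feasible_def intro: order_antisym)
  ultimately have "\<exists>p. SRAP G C M lev p" if "leveling G M lev" for lev
    using SRAP_exists N(2) that by blast
  \<comment> \<open>As \<open>M\<close> is popular but not dominant, some larger feasible matching
    does not lose against it; by popularity it does not win either.\<close>
  moreover obtain N' where N': "feasible G C N'" "card M < card N'" "\<not> phi G N' M < phi G M N'"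
    using assms(3,5) by (auto simp: dominant_feasible_def)
  moreover have "phi G N' M = phi G M N'"
    using assms(3) N' by (auto simp: popular_feasible_def intro: order_antisym)
  ultimately show ?thesis
    using leveling_exists SIAP_exists by blast
qed

end
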